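(* Let $X$ be a nonzero real Banach space, let $h : X \to\, ]-\infty,\infty]$ be proper and convex, and let $k : X \to\, ]-\infty,\infty]$ be lower semicontinuous with $k \le h$ on $X$. For all $x \in X$, let $$f(x) := \sup_{x^* \in X^*}\big[\langle x, x^*\rangle - h^*(x^* )\big]$$ (that is, $f(x) = h^{**}(\widehat{x})$). Then: (a) $f \ge k$ on $X$, and so $f : X \to\, ]-\infty,\infty]$. (b) $f$ is proper, convex and lower semicontinuous on $X$, and $f^* = h^*$ on $X^*$.
   Context: A function $g : X \to\, ]-\infty,\infty]$ is proper if it is finite at some point. $X^*$ is the dual of $X$, with pairing $\langle x, x^*\rangle$. The Fenchel conjugate of a proper convex function $g$ on $X$ is $g^*(x^* ) := \sup_{x \in X}[\langle x, x^*\rangle - g(x)]$ for $x^* \in X^*$. $X^{**}$ is the bidual, $\widehat{x}$ denotes the canonical image of $x \in X$ in $X^{**}$, and $h^{**}(x^{**}) := \sup_{x^* \in X^*}[\langle x^*, x^{**}\rangle - h^*(x^* )]$. *)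

theory Defs
  imports "HOL-Analysis.Analysis"
begin

text \<open>
  A function into \<open>]-\<infinity>,\<infinity>]\<close> is modelled as an \<^typ>\<open>ereal\<close>-valued function that never
  takes the value \<open>-\<infinity>\<close>; this condition is stated separately wherever it is needed.
  The dual space of \<open>'a\<close> is the type \<open>'a \<Rightarrow>\<^sub>L real\<close> of bounded linear functionals.
\<close>

definition proper_fun :: "('a \<Rightarrow> ereal) \<Rightarrow> bool"
  where "proper_fun g \<longleftrightarrow> (\<exists>x. \<bar>g x\<bar> \<noteq> \<infinity>)"

text \<open>
  The right-hand side never has the form \<open>\<infinity> - \<infinity>\<close> if \<open>g\<close> avoids \<open>-\<infinity>\<close>, so the convention
  of \<^typ>\<open>ereal\<close> for this expression plays no role.
\<close>

definition convex_fun :: "('a::real_vector \<Rightarrow> ereal) \<Rightarrow> bool"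
  where "convex_fun g \<longleftrightarrow>
    (\<forall>x y. \<forall>t::real. 0 < t \<and> t < 1 \<longrightarrow>
      g ((1 - t) *\<^sub>R x + t *\<^sub>R y) \<le> ereal (1 - t) * g x + ereal t * g y)"

definition lower_semicontinuous :: "('a::topological_space \<Rightarrow> ereal) \<Rightarrow> bool"
  where "lower_semicontinuous g \<longleftrightarrow> (\<forall>x. \<forall>c < g x. \<forall>\<^sub>F y in nhds x. c < g y)"

definition fenchel_conj :: "('a::real_normed_vector \<Rightarrow> ereal) \<Rightarrow> ('a \<Rightarrow>\<^sub>L real) \<Rightarrow> ereal"
  where "fenchel_conj g xs = (SUP x. ereal (blinfun_apply xs x) - g x)"

text \<open>
  The supremum runs over the dual space, and the argument lies in the bidual: it is the
  conjugate of \<open>g\<^sup>*\<close> as a function on the normed space \<open>'a \<Rightarrow>\<^sub>L real\<close>.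
\<close>

definition fenchel_biconj ::
    "('a::real_normed_vector \<Rightarrow> ereal) \<Rightarrow> (('a \<Rightarrow>\<^sub>L real) \<Rightarrow>\<^sub>L real) \<Rightarrow> ereal"
  where "fenchel_biconj g = fenchel_conj (fenchel_conj g)"

definition bidual_embed :: "'a::real_normed_vector \<Rightarrow> (('a \<Rightarrow>\<^sub>L real) \<Rightarrow>\<^sub>L real)"
  where "bidual_embed x = Blinfun (\<lambda>xs. blinfun_apply xs x)"

lemma bidual_embed_apply [simp]:
  "blinfun_apply (bidual_embed x) xs = blinfun_apply xs x"
  unfolding bidual_embed_def
  by (simp add: bounded_linear_Blinfun_apply blinfun.bounded_linear_left)

end

theory Submission
  imports Defs
begin

text \<open>
  The inequality \<open>f \<le> h\<close> and the identity \<open>f\<^sup>* = h\<^sup>*\<close> are formal consequences of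
  the Fenchel--Young inequality, and \<open>f\<close> is convex and lower semicontinuous because it is a
  supremum of continuous affine functions. The real content is \<open>k \<le> f\<close>: for every real
  \<open>c < k x\<close> there must be a continuous affine minorant of \<open>h\<close> with value \<open>c\<close> at \<open>x\<close>. Since \<open>k\<close>
  avoids \<open>-\<infinity>\<close>, so does \<open>f\<close>.

  Such a minorant is found in two steps. First, the minorant \<open>k\<close> bounds \<open>h\<close> from below near \<open>x\<close>
  by \<open>c\<close>, and also near a point \<open>x0\<close> where \<open>h\<close> is finite. Convexity turns the local bound at
  \<open>x0\<close> into a global bound \<open>a - B \<cdot> norm (y - x0)\<close>, see \<open>convex_fun_linear_growth\<close>. Taken
  together, the two bounds give a cone \<open>c - M \<cdot> norm (y - x)\<close> with apex \<open>(x, c)\<close> below \<open>h\<close>, once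
  \<open>M\<close> is large enough. Second, an affine function fits between this concave cone and the convex
  function \<open>h\<close>, see \<open>affine_minorant_above_cone\<close>. Separating a cone of finite slope, rather than
  the point \<open>(x, c)\<close>, from the epigraph of \<open>h\<close> excludes vertical hyperplanes from the outset,
  so points where \<open>h\<close> is infinite need no special treatment.

  The second step is the theorem of Mazur and Orlicz, applied to the sublinear functional
  \<open>(w, r) \<mapsto> M \<cdot> norm w + r\<close> on the product of the space with the reals. That theorem follows
  from the Hahn--Banach theorem in the form ``every sublinear functional dominates a linear one'',
  which holds because the minimal sublinear functionals are exactly the linear ones.
\<close>

section \<open>Sublinear functionals\<close>

definition sublinear :: "('a::real_vector \<Rightarrow> real) \<Rightarrow> bool"
  where "sublinear p \<longleftrightarrow>
    (\<forall>x y. p (x + y) \<le> p x + p y) \<and> (\<forall>x. \<forall>t>0. p (t *\<^sub>R x) = t * p x)"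

lemma sublinear_add: "sublinear p \<Longrightarrow> p (x + y) \<le> p x + p y"
  by (simp add: sublinear_def)

lemma sublinear_scaleR_pos: "sublinear p \<Longrightarrow> 0 < t \<Longrightarrow> p (t *\<^sub>R x) = t * p x"
  by (simp add: sublinear_def)

lemma sublinear_0: "sublinear p \<Longrightarrow> p 0 = 0"
  using sublinear_scaleR_pos[of p 2 0] by simp

lemma sublinear_scaleR: "sublinear p \<Longrightarrow> 0 \<le> t \<Longrightarrow> p (t *\<^sub>R x) = t * p x"
  by (cases "t = 0") (simp_all add: sublinear_0 sublinear_scaleR_pos)

lemma sublinear_minus: "sublinear p \<Longrightarrow> - p (- x) \<le> p x"
  using sublinear_add[of p x "- x"] sublinear_0[of p] by simp

text \<open>
  The index on the left may depend on the arguments, and positive homogeneity is only asked for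
  as an inequality: the converse comes from the inverse factor. This covers infima of chains as
  well as infimal convolutions.
\<close>

lemma sublinear_INF:
  fixes F :: "'i \<Rightarrow> 'a::real_vector \<Rightarrow> real"
  assumes ne: "I \<noteq> {}" and bdd: "\<And>x. bdd_below ((\<lambda>i. F i x) ` I)"
    and add: "\<And>i j x y. i \<in> I \<Longrightarrow> j \<in> I \<Longrightarrow> \<exists>l\<in>I. F l (x + y) \<le> F i x + F j y"
    and scale: "\<And>i t x. i \<in> I \<Longrightarrow> 0 < t \<Longrightarrow> \<exists>l\<in>I. F l (t *\<^sub>R x) \<le> t * F i x"
  shows "sublinear (\<lambda>x. INF i\<in>I. F i x)"
proof -
  define G where "G x = (INF i\<in>I. F i x)" for x
  have lower: "G x \<le> F i x" if "i \<in> I" for i x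
    unfolding G_def by (rule cINF_lower[OF bdd that])
  have greatest: "b \<le> G x" if "\<And>i. i \<in> I \<Longrightarrow> b \<le> F i x" for b x
    unfolding G_def using that ne by (simp add: cINF_greatest)
  have G_add: "G (x + y) \<le> G x + G y" for x y
  proof -
    have step: "G (x + y) \<le> F i x + F j y" if "i \<in> I" "j \<in> I" for i j
      using add[OF that, of x y] lower[of _ "x + y"] by fastforce
    have "G (x + y) - F i x \<le> G y" if "i \<in> I" for i
      using step[OF that] by (intro greatest) (simp add: algebra_simps)
    then have "G (x + y) - G y \<le> G x"
      by (intro greatest) (simp add: algebra_simps)
    then show ?thesis by simp
  qed
  have G_scale_le: "G (t *\<^sub>R x) \<le> t * G x" if t: "0 < t" for t x
  proof -
    have "G (t *\<^sub>R x) / t \<le> F i x" if "i \<in> I" for i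
      using scale[OF that t, of x] lower[of _ "t *\<^sub>R x"] t
      by (fastforce simp: pos_divide_le_eq mult.commute)
    then have "G (t *\<^sub>R x) / t \<le> G x"
      by (rule greatest)
    then show ?thesis
      using t by (simp add: pos_divide_le_eq mult.commute)
  qed
  have "G (t *\<^sub>R x) = t * G x" if t: "0 < t" for t x
    using G_scale_le[OF t, of x] G_scale_le[of "inverse t" "t *\<^sub>R x"] t
    by (simp add: field_simps)
  with G_add have "sublinear G"
    by (simp add: sublinear_def)
  then show ?thesis
    by (simp add: G_def[abs_def])
qed

text \<open>
  For fixed \<open>y\<close>, pushing \<open>q\<close> along the ray spanned by \<open>y\<close> gives the sublinear functional
  \<open>x \<mapsto> inf\<^sub>t (q (x + t y) - t q y)\<close> below \<open>q\<close>. If \<open>q\<close> is minimal, the two agree, and the term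
  for \<open>t = 1\<close> yields the reverse of subadditivity.
\<close>

lemma minimal_sublinear_imp_linear:
  fixes q :: "'a::real_vector \<Rightarrow> real"
  assumes q: "sublinear q" and minimal: "\<And>q'. sublinear q' \<Longrightarrow> q' \<le> q \<Longrightarrow> q' = q"
  shows "linear q"
proof -
  have additive: "q (x + y) = q x + q y" for x y
  proof -
    let ?F = "\<lambda>t x. q (x + t *\<^sub>R y) - t * q y"
    define r where "r x = (INF t\<in>{0..}. ?F t x)" for x
    have low: "- q (- x) \<le> ?F t x" if "0 \<le> t" for t x
      using sublinear_add[OF q, of "x + t *\<^sub>R y" "- x"] sublinear_scaleR[OF q that, of y]
      by simp
    have bdd: "bdd_below ((\<lambda>t. ?F t x) ` {0..})" for x
      using low by (intro bdd_belowI2[of _ "- q (- x)"]) auto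
    have "sublinear (\<lambda>x. INF t\<in>{0..}. ?F t x)"
    proof (rule sublinear_INF[OF _ bdd])
      fix s t x z assume st: "s \<in> {0::real..}" "t \<in> {0::real..}"
      have "?F (s + t) (x + z) \<le> ?F s x + ?F t z"
        using sublinear_add[OF q, of "x + s *\<^sub>R y" "z + t *\<^sub>R y"] by (simp add: algebra_simps)
      then show "\<exists>l\<in>{0..}. ?F l (x + z) \<le> ?F s x + ?F t z"
        using st by (intro bexI[of _ "s + t"]) auto
    next
      fix s t :: real and x assume s: "s \<in> {0..}" and t: "0 < t"
      have "?F (t * s) (t *\<^sub>R x) = t * ?F s x"
        using sublinear_scaleR_pos[OF q t, of "x + s *\<^sub>R y"] by (simp add: algebra_simps)
      then show "\<exists>l\<in>{0..}. ?F l (t *\<^sub>R x) \<le> t * ?F s x"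
        using s t by (intro bexI[of _ "t * s"]) auto
    qed simp
    then have "sublinear r"
      by (simp add: r_def[abs_def])
    moreover have r_le: "r x \<le> ?F t x" if "0 \<le> t" for x t
      unfolding r_def by (rule cINF_lower[OF bdd]) (use that in simp)
    have "r \<le> q"
      using r_le[of 0] by (simp add: le_fun_def)
    ultimately have "r = q"
      by (rule minimal)
    then have "q x + q y \<le> q (x + y)"
      using r_le[of 1 x] by simp
    then show ?thesis
      using sublinear_add[OF q, of x y] by simp
  qed
  have minus: "q (- x) = - q x" for x
    using additive[of x "- x"] sublinear_0[OF q] by simp
  have "q (t *\<^sub>R x) = t * q x" for t x
    using sublinear_scaleR[OF q, of t x] sublinear_scaleR[OF q, of "- t" x] minus[of "t *\<^sub>R x"]
    by (cases "0 \<le> t") auto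
  then show ?thesis
    using additive by (intro linearI) auto
qed

text \<open>
  Zorn's lemma provides a minimal sublinear functional: the infimum of a chain below \<open>p\<close> is
  finite, since \<open>q x \<ge> - q (- x) \<ge> - p (- x)\<close> for each of its members \<open>q\<close>.
\<close>

theorem sublinear_dominates_linear:
  fixes p :: "'a::real_vector \<Rightarrow> real"
  assumes p: "sublinear p"
  obtains L where "linear L" "\<And>x. L x \<le> p x"
proof -
  define A where "A = {q. sublinear q \<and> q \<le> p}"
  have "\<exists>m\<in>A. \<forall>q\<in>A. q \<le> m \<longrightarrow> q = m"
  proof (rule predicate_Zorn[where P = "\<lambda>q q'. q' \<le> q"])
    show "partial_order_on A (relation_of (\<lambda>q q'. q' \<le> q) A)"
      by (rule partial_order_on_relation_ofI) auto
  next
    fix C assume C: "C \<in> Chains (relation_of (\<lambda>q q'. q' \<le> q) A)"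
    then have sub: "C \<subseteq> A" and chain: "\<And>q q'. q \<in> C \<Longrightarrow> q' \<in> C \<Longrightarrow> q \<le> q' \<or> q' \<le> q"
      by (auto simp: Chains_def relation_of_def)
    show "\<exists>u\<in>A. \<forall>q\<in>C. u \<le> q"
    proof (cases "C = {}")
      case True
      then show ?thesis using p by (auto simp: A_def)
    next
      case False
      define u where "u x = (INF q\<in>C. q x)" for x
      have low: "- p (- x) \<le> q x" if "q \<in> C" for q x
      proof -
        have "sublinear q" "q (- x) \<le> p (- x)"
          using that sub by (auto simp: A_def le_fun_def)
        then show ?thesis
          using sublinear_minus[of q x] by simp
      qed
      have bdd: "bdd_below ((\<lambda>q. q x) ` C)" for x
        using low by (intro bdd_belowI2[of _ "- p (- x)"]) auto
      have "sublinear (\<lambda>x. INF q\<in>C. q x)"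
      proof (rule sublinear_INF[OF False bdd])
        fix q q' x y assume qq': "q \<in> C" "q' \<in> C"
        \<comment> \<open>The smaller of the two functionals serves as the common index.\<close>
        from chain[OF qq'] show "\<exists>l\<in>C. l (x + y) \<le> q x + q' y"
        proof
          assume "q \<le> q'"
          then have "q y \<le> q' y"
            by (simp add: le_fun_def)
          then show ?thesis
            using qq' sub sublinear_add[of q x y] by (intro bexI[of _ q]) (auto simp: A_def)
        next
          assume "q' \<le> q"
          then have "q' x \<le> q x"
            by (simp add: le_fun_def)
          then show ?thesis
            using qq' sub sublinear_add[of q' x y] by (intro bexI[of _ q']) (auto simp: A_def)
        qed
      next
        fix q :: "'a \<Rightarrow> real" and t :: real and x assume "q \<in> C" "0 < t"
        then show "\<exists>l\<in>C. l (t *\<^sub>R x) \<le> t * q x"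
          using sub sublinear_scaleR_pos[of q t x] by (intro bexI[of _ q]) (auto simp: A_def)
      qed
      then have "sublinear u"
        by (simp add: u_def[abs_def])
      moreover have u_le: "u \<le> q" if "q \<in> C" for q
        unfolding u_def le_fun_def by (auto intro: cINF_lower[OF bdd that])
      moreover have "u \<le> p"
      proof -
        obtain q where q: "q \<in> C"
          using False by blast
        then have "q \<le> p"
          using sub by (auto simp: A_def)
        with u_le[OF q] show ?thesis
          by (rule order_trans)
      qed
      ultimately show ?thesis
        by (auto simp: A_def)
    qed
  qed
  then obtain m where m: "sublinear m" "m \<le> p" and min: "\<And>q. q \<in> A \<Longrightarrow> q \<le> m \<Longrightarrow> q = m"
    by (auto simp: A_def)
  have "linear m"
    using m(1)
  proof (rule minimal_sublinear_imp_linear)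
    fix q assume "sublinear q" "q \<le> m"
    then show "q = m"
      using min order_trans[OF _ m(2)] by (simp add: A_def)
  qed
  with m that show ?thesis
    by (auto simp: le_fun_def)
qed

text \<open>
  Over the convex cone \<open>K\<close> generated by \<open>C\<close>, the infimum of \<open>S (x + v)\<close> with \<open>v \<in> K\<close> is
  sublinear in \<open>x\<close>; it is finite because \<open>S\<close> is nonnegative on \<open>K\<close>. It is at most \<open>S 0 = 0\<close> at
  every point of \<open>- C\<close>, so a linear functional below it is nonnegative on \<open>C\<close>.
\<close>

theorem Mazur_Orlicz:
  fixes S :: "'a::real_vector \<Rightarrow> real"
  assumes S: "sublinear S" and C: "convex C" "C \<noteq> {}" and nonneg: "\<And>v. v \<in> C \<Longrightarrow> 0 \<le> S v"
  obtains L where "linear L" "\<And>x. L x \<le> S x" "\<And>v. v \<in> C \<Longrightarrow> 0 \<le> L v"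
proof -
  define K where "K = conic hull C"
  have K: "convex_cone K"
    using C by (auto simp: K_def convex_cone_def convex_conic_hull conic_conic_hull
        conic_hull_eq_empty)
  have K_nonneg: "0 \<le> S v" if "v \<in> K" for v
    using that nonneg sublinear_scaleR[OF S] by (auto simp: K_def conic_hull_explicit)
  have K0: "0 \<in> K"
    using K by (simp add: convex_cone_iff)
  have low: "- S (- x) \<le> S (x + v)" if "v \<in> K" for x v
    using sublinear_add[OF S, of "x + v" "- x"] K_nonneg[OF that] by simp
  have bdd: "bdd_below ((\<lambda>v. S (x + v)) ` K)" for x
    using low by (intro bdd_belowI2[of _ "- S (- x)"]) auto
  have "sublinear (\<lambda>x. INF v\<in>K. S (x + v))"
  proof (rule sublinear_INF[OF _ bdd])
    fix v w x y assume vw: "v \<in> K" "w \<in> K"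
    have "S (x + y + (v + w)) \<le> S (x + v) + S (y + w)"
      using sublinear_add[OF S, of "x + v" "y + w"] by (simp add: algebra_simps)
    then show "\<exists>l\<in>K. S (x + y + l) \<le> S (x + v) + S (y + w)"
      using convex_cone_add[OF K vw] by blast
  next
    fix v x and t :: real assume v: "v \<in> K" and t: "0 < t"
    have "S (t *\<^sub>R x + t *\<^sub>R v) = t * S (x + v)"
      using sublinear_scaleR_pos[OF S t, of "x + v"] by (simp add: algebra_simps)
    then show "\<exists>l\<in>K. S (t *\<^sub>R x + l) \<le> t * S (x + v)"
      using convex_cone_scaleR[OF K _ v, of t] t by force
  qed (use K0 in blast)
  then obtain L where L: "linear L" "\<And>x. L x \<le> (INF v\<in>K. S (x + v))"
    by (rule sublinear_dominates_linear) auto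
  have le: "L x \<le> S (x + v)" if "v \<in> K" for x v
    using L(2)[of x] cINF_lower[OF bdd that, of x] by simp
  show ?thesis
  proof
    show "linear L" by fact
    show "L x \<le> S x" for x
      using le[OF K0, of x] by simp
    show "0 \<le> L v" if "v \<in> C" for v
    proof -
      have "v \<in> K"
        using that by (simp add: K_def hull_inc)
      from le[OF this, of "- v"] show ?thesis
        using sublinear_0[OF S] linear_neg[OF L(1), of v] by simp
    qed
  qed
qed

section \<open>Continuous affine minorants of convex functions\<close>

lemma convex_epigraph_fun:
  assumes g: "convex_fun g"
  shows "convex {(y, r::real). g y \<le> ereal r}"
proof -
  have "g ((1 - t) *\<^sub>R x + t *\<^sub>R y) \<le> ereal ((1 - t) * r + t * s)"
    if gx: "g x \<le> ereal r" and gy: "g y \<le> ereal s" and t: "0 \<le> t" "t \<le> 1" for x y r s t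
  proof -
    consider "t = 0" | "t = 1" | "0 < t" "t < 1"
      using t by linarith
    then show ?thesis
    proof cases
      case 3
      then have "g ((1 - t) *\<^sub>R x + t *\<^sub>R y) \<le> ereal (1 - t) * g x + ereal t * g y"
        using g by (simp add: convex_fun_def)
      also have "\<dots> \<le> ereal (1 - t) * ereal r + ereal t * ereal s"
        using gx gy t by (intro add_mono ereal_mult_left_mono) auto
      finally show ?thesis by simp
    qed (use gx gy in simp_all)
  qed
  then show ?thesis
    by (auto simp: convex_alt)
qed

text \<open>
  This is a sandwich theorem: the graph of the affine function lies between the cone and the
  graph of \<open>g\<close>. On the product of \<open>'a\<close> with the reals, \<open>S (w, r) = M * norm w + r\<close> is nonnegative
  on the epigraph of \<open>g\<close> translated by \<open>- (x, c)\<close>. A linear functional below \<open>S\<close> has the form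
  \<open>(w, r) \<mapsto> T w + r\<close> with \<open>T w \<le> M * norm w\<close>, so that \<open>- T\<close> is the required slope.
\<close>

lemma affine_minorant_above_cone:
  fixes g :: "'a::real_normed_vector \<Rightarrow> ereal"
  assumes g: "convex_fun g" and fin: "g x0 \<noteq> \<infinity>" and M: "0 \<le> M"
    and cone: "\<And>y. ereal (c - M * norm (y - x)) \<le> g y"
  obtains xs :: "'a \<Rightarrow>\<^sub>L real" where "\<And>y. ereal (c + xs (y - x)) \<le> g y"
proof -
  define S where "S v = M * norm (fst v) + snd v" for v :: "'a \<times> real"
  define E where "E = {(y, r). g y \<le> ereal r}"
  define C where "C = (\<lambda>v. v - (x, c)) ` E"
  have S: "sublinear S"
    using M mult_left_mono[OF norm_triangle_ineq M]
    by (auto simp: sublinear_def S_def algebra_simps)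
  have "convex C"
    unfolding C_def E_def by (intro convex_translation_subtract convex_epigraph_fun g)
  moreover have "C \<noteq> {}"
  proof -
    obtain r where "g x0 \<le> ereal r"
      using fin by (cases "g x0") auto
    then show ?thesis
      by (auto simp: C_def E_def)
  qed
  moreover have "0 \<le> S v" if v_in: "v \<in> C" for v
  proof -
    obtain y r where "(y, r) \<in> E" and v: "v = (y - x, r - c)"
      using v_in by (auto simp: C_def)
    then have "g y \<le> ereal r"
      by (simp add: E_def)
    with cone[of y] have "ereal (c - M * norm (y - x)) \<le> ereal r"
      by (blast intro: order_trans)
    then show ?thesis
      by (simp add: v S_def)
  qed
  ultimately obtain L where L: "linear L" and LS: "\<And>v. L v \<le> S v"
      and LC: "\<And>v. v \<in> C \<Longrightarrow> 0 \<le> L v"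
    using Mazur_Orlicz[OF S] by metis
  have L_snd: "L (0, r) = r" for r
    using LS[of "(0, r)"] LS[of "- (0, r)"] linear_neg[OF L, of "(0, r)"] by (simp add: S_def)
  have L_split: "L (w, r) = L (w, 0) + r" for w r
    using linear_add[OF L, of "(w, 0)" "(0, r)"] by (simp add: L_snd)
  define T where "T w = - L (w, 0)" for w
  have T: "bounded_linear T"
  proof (rule bounded_linear_intro[where K = M])
    show "T (v + w) = T v + T w" for v w
      using linear_add[OF L, of "(v, 0)" "(w, 0)"] by (simp add: T_def)
    show "T (t *\<^sub>R w) = t *\<^sub>R T w" for t w
      using linear_scale[OF L, of t "(w, 0)"] by (simp add: T_def)
    show "norm (T w) \<le> norm w * M" for w
      using LS[of "(w, 0)"] LS[of "- (w, 0)"] linear_neg[OF L, of "(w, 0)"]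
      by (simp add: T_def S_def mult.commute abs_le_iff)
  qed
  show ?thesis
  proof
    fix y
    have "c + T (y - x) \<le> r" if "g y \<le> ereal r" for r
    proof -
      have "(y - x, r - c) \<in> C"
        using that by (force simp: C_def E_def)
      from LC[OF this] show ?thesis
        using L_split[of "y - x" "r - c"] by (simp add: T_def)
    qed
    then have "ereal (c + T (y - x)) \<le> g y"
      by (rule ereal_le_real[OF iffD2[OF ereal_less_eq(3)]])
    then show "ereal (c + blinfun_apply (Blinfun T) (y - x)) \<le> g y"
      by (simp add: bounded_linear_Blinfun_apply T)
  qed
qed

text \<open>
  On the segment from \<open>x0\<close> to a far away point \<open>y\<close>, the function is finite at \<open>x0\<close> and bounded
  below at distance \<open>e / 2\<close>. Convexity prevents it from descending faster than linearly after
  that point.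
\<close>

lemma convex_fun_linear_growth:
  fixes g :: "'a::real_normed_vector \<Rightarrow> ereal"
  assumes g: "convex_fun g" and gx0: "g x0 = ereal H" and e: "0 < e"
    and near: "\<And>y. norm (y - x0) < e \<Longrightarrow> ereal a \<le> g y"
  obtains B where "0 \<le> B" "\<And>y. ereal (a - B * norm (y - x0)) \<le> g y"
proof -
  define B where "B = 2 * (H - a) / e"
  have aH: "a \<le> H"
    using near[of x0] gx0 e by simp
  then have B: "0 \<le> B"
    using e by (simp add: B_def)
  moreover have "ereal (a - B * norm (y - x0)) \<le> g y" for y
  proof (cases "norm (y - x0) < e")
    case True
    have "ereal (a - B * norm (y - x0)) \<le> ereal a"
      using B by simp
    also have "\<dots> \<le> g y"
      by (rule near[OF True])
    finally show ?thesis .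
  next
    case False
    define n where "n = norm (y - x0)"
    define t where "t = e / (2 * n)"
    define z where "z = (1 - t) *\<^sub>R x0 + t *\<^sub>R y"
    have n: "e \<le> n" "0 < n"
      using False e by (auto simp: n_def)
    then have t: "0 < t" "t < 1"
      using e by (auto simp: t_def divide_simps)
    have "z - x0 = t *\<^sub>R (y - x0)"
      by (simp add: z_def algebra_simps)
    then have "norm (z - x0) = t * n"
      using t by (simp add: n_def)
    also have "\<dots> < e"
      using n e by (simp add: t_def)
    finally have "ereal a \<le> g z"
      by (rule near)
    also have "g z \<le> ereal (1 - t) * g x0 + ereal t * g y"
      unfolding z_def using g t by (simp add: convex_fun_def)
    finally have segment: "ereal a \<le> ereal ((1 - t) * H) + ereal t * g y"
      by (simp add: gx0)
    have "a - B * n \<le> r" if gy: "g y \<le> ereal r" for r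
    proof -
      have "ereal ((1 - t) * H) + ereal t * g y \<le> ereal ((1 - t) * H) + ereal t * ereal r"
        using gy t by (intro add_left_mono ereal_mult_left_mono) auto
      from order_trans[OF segment this] have "a \<le> (1 - t) * H + t * r"
        by simp
      then have "(a - H) \<le> t * (r - H)"
        by (simp add: algebra_simps)
      then have "(a - H) / t \<le> r - H"
        using t by (simp add: pos_divide_le_eq mult.commute)
      moreover have "(a - H) / t = - B * n"
        using e n by (simp add: t_def B_def field_simps)
      ultimately show ?thesis
        using aH by simp
    qed
    then have "ereal (a - B * n) \<le> g y"
      by (rule ereal_le_real[OF iffD2[OF ereal_less_eq(3)]])
    then show ?thesis
      by (simp add: n_def)
  qed
  ultimately show ?thesis
    using that by blast
qed

lemma lower_semicontinuous_ball:
  fixes k :: "'a::metric_space \<Rightarrow> ereal"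
  assumes "lower_semicontinuous k" "c < k x"
  obtains e where "0 < e" "\<And>y. dist y x < e \<Longrightarrow> c < k y"
  using assms unfolding lower_semicontinuous_def eventually_nhds_metric by blast

text \<open>
  Near \<open>x\<close> the bound \<open>c\<close> of \<open>h\<close> suffices. Away from \<open>x\<close>, at distance at least \<open>e\<close>, the surplus
  slope \<open>M - B\<close> compensates the difference of the constant terms.
\<close>

lemma affine_minorant_below_lsc_minorant:
  fixes h k :: "'a::real_normed_vector \<Rightarrow> ereal"
  assumes h: "convex_fun h" and h_fin: "\<bar>h x0\<bar> \<noteq> \<infinity>"
    and k: "lower_semicontinuous k" "\<And>x. k x \<noteq> - \<infinity>" "\<And>x. k x \<le> h x"
    and c: "ereal c < k x"
  obtains xs :: "'a \<Rightarrow>\<^sub>L real" where "\<And>y. ereal (c + xs (y - x)) \<le> h y"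
proof -
  obtain H where H: "h x0 = ereal H"
    using h_fin by auto
  obtain a where "ereal a < k x0"
    using k(2)[of x0] ereal_dense2[of "- \<infinity>" "k x0"] by auto
  then obtain d where d: "0 < d" "\<And>y. dist y x0 < d \<Longrightarrow> ereal a < k y"
    using lower_semicontinuous_ball[OF k(1)] by metis
  have "ereal a \<le> h y" if "norm (y - x0) < d" for y
    using d(2)[of y] that k(3)[of y] by (simp add: dist_norm order_less_imp_le order_less_le_trans)
  then obtain B where B: "0 \<le> B" "\<And>y. ereal (a - B * norm (y - x0)) \<le> h y"
    using convex_fun_linear_growth[OF h H d(1)] by metis
  obtain e where e: "0 < e" "\<And>y. dist y x < e \<Longrightarrow> ereal c < k y"
    using lower_semicontinuous_ball[OF k(1) c] by metis
  define D where "D = \<bar>c - a + B * norm (x - x0)\<bar>"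
  define M where "M = B + D / e"
  have M: "0 \<le> M"
    using B e by (simp add: M_def D_def)
  have "ereal (c - M * norm (y - x)) \<le> h y" for y
  proof (cases "norm (y - x) < e")
    case True
    have "ereal (c - M * norm (y - x)) \<le> ereal c"
      using M by simp
    also have "ereal c \<le> k y"
      using e(2)[of y] True by (simp add: dist_norm order_less_imp_le)
    also have "k y \<le> h y"
      by (rule k(3))
    finally show ?thesis .
  next
    case False
    have "D = D / e * e"
      using e by simp
    also have "\<dots> \<le> D / e * norm (y - x)"
      using False e by (intro mult_left_mono) (auto simp: D_def)
    finally have "D + B * norm (y - x) \<le> M * norm (y - x)"
      by (simp add: M_def algebra_simps)
    moreover have "B * norm (y - x0) \<le> B * norm (y - x) + B * norm (x - x0)"
      using B(1) norm_triangle_ineq[of "y - x" "x - x0"]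
      by (simp flip: distrib_left add: mult_left_mono)
    ultimately have "c - M * norm (y - x) \<le> a - B * norm (y - x0)"
      unfolding D_def by linarith
    then have "ereal (c - M * norm (y - x)) \<le> ereal (a - B * norm (y - x0))"
      by simp
    also have "\<dots> \<le> h y"
      by (rule B(2))
    finally show ?thesis .
  qed
  then show ?thesis
    using affine_minorant_above_cone[OF h _ M, of x0 c x] H that by auto
qed

section \<open>Conjugates\<close>

lemma fenchel_young: "ereal (blinfun_apply xs x) - g x \<le> fenchel_conj g xs"
  unfolding fenchel_conj_def by (rule SUP_upper) simp

lemma fenchel_conj_antimono:
  assumes "\<And>x. g x \<le> h x"
  shows "fenchel_conj h xs \<le> fenchel_conj g xs"
  unfolding fenchel_conj_def using assms by (intro SUP_mono) (auto intro: ereal_minus_mono)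

lemma fenchel_conj_le_of_affine_minorant:
  assumes "\<And>y. ereal (c + blinfun_apply xs (y - x)) \<le> h y"
  shows "fenchel_conj h xs \<le> ereal (blinfun_apply xs x - c)"
  unfolding fenchel_conj_def
proof (rule SUP_least)
  fix y
  show "ereal (blinfun_apply xs y) - h y \<le> ereal (blinfun_apply xs x - c)"
    using assms[of y] by (cases "h y") (auto simp: blinfun.diff_right)
qed

lemma fenchel_conj_neq_MInf:
  assumes "h x0 \<noteq> \<infinity>"
  shows "fenchel_conj h xs \<noteq> - \<infinity>"
  using fenchel_young[of xs x0 h] assms by (cases "h x0") auto

text \<open>
  The next two lemmas concern an arbitrary supremum of continuous affine functions; \<open>b\<close> plays
  the part of the conjugate. An index with \<open>b xs = \<infinity>\<close> contributes the constant \<open>-\<infinity>\<close>.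
\<close>

lemma convex_fun_SUP_affine:
  fixes b :: "('a::real_normed_vector \<Rightarrow>\<^sub>L real) \<Rightarrow> ereal"
  assumes b: "\<And>xs. b xs \<noteq> - \<infinity>"
  shows "convex_fun (\<lambda>x. SUP xs. ereal (blinfun_apply xs x) - b xs)"
  unfolding convex_fun_def
proof (intro allI impI, elim conjE, rule SUP_least)
  fix x y :: 'a and t :: real and xs :: "'a \<Rightarrow>\<^sub>L real"
  assume t: "0 < t" "t < 1"
  let ?f = "\<lambda>x. SUP xs. ereal (blinfun_apply xs x) - b xs"
  show "ereal (xs ((1 - t) *\<^sub>R x + t *\<^sub>R y)) - b xs
      \<le> ereal (1 - t) * ?f x + ereal t * ?f y"
  proof (cases "b xs")
    case (real r)
    have le: "ereal (xs z - r) \<le> ?f z" for z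
      using SUP_upper[of xs UNIV "\<lambda>xs. ereal (blinfun_apply xs z) - b xs"] real by simp
    have "ereal (xs ((1 - t) *\<^sub>R x + t *\<^sub>R y)) - b xs
        = ereal (1 - t) * ereal (xs x - r) + ereal t * ereal (xs y - r)"
      by (simp add: real blinfun.add_right blinfun.scaleR_right blinfun.diff_right algebra_simps)
    also have "\<dots> \<le> ereal (1 - t) * ?f x + ereal t * ?f y"
      using t by (intro add_mono ereal_mult_left_mono le) auto
    finally show ?thesis .
  qed (use b in auto)
qed

lemma lower_semicontinuous_SUP_affine:
  fixes b :: "('a::real_normed_vector \<Rightarrow>\<^sub>L real) \<Rightarrow> ereal"
  assumes b: "\<And>xs. b xs \<noteq> - \<infinity>"
  shows "lower_semicontinuous (\<lambda>x. SUP xs. ereal (blinfun_apply xs x) - b xs)"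
  unfolding lower_semicontinuous_def
proof (intro allI impI)
  fix x :: 'a and c
  assume "c < (SUP xs. ereal (blinfun_apply xs x) - b xs)"
  then obtain xs where xs: "c < ereal (blinfun_apply xs x) - b xs"
    by (auto simp: less_SUP_iff)
  then obtain r where r: "b xs = ereal r"
    using b[of xs] by (cases "b xs") auto
  have "((\<lambda>y. ereal (xs y - r)) \<longlongrightarrow> ereal (xs x - r)) (nhds x)"
    by (intro tendsto_intros) (simp add: filterlim_ident)
  then have "\<forall>\<^sub>F y in nhds x. c < ereal (xs y - r)"
    by (rule order_tendstoD) (use xs r in simp)
  then show "\<forall>\<^sub>F y in nhds x. c < (SUP xs. ereal (blinfun_apply xs y) - b xs)"
  proof eventually_elim
    case (elim y)
    also have "ereal (xs y - r) = ereal (xs y) - b xs"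
      by (simp add: r)
    also have "\<dots> \<le> (SUP xs. ereal (blinfun_apply xs y) - b xs)"
      by (rule SUP_upper) simp
    finally show ?case .
  qed
qed

section \<open>The biconjugate on the original space\<close>

theorem theorem2p3:
  fixes h k f :: "'a::banach \<Rightarrow> ereal"
  assumes nonzero: "\<exists>x::'a. x \<noteq> 0"
    and h_gt: "\<forall>x. h x \<noteq> -\<infinity>" and h_proper: "proper_fun h" and h_convex: "convex_fun h"
    and k_gt: "\<forall>x. k x \<noteq> -\<infinity>" and k_lsc: "lower_semicontinuous k"
    and k_le_h: "\<forall>x. k x \<le> h x"
    and f_eq: "\<forall>x. f x = (SUP xs::'a \<Rightarrow>\<^sub>L real. ereal (blinfun_apply xs x) - fenchel_conj h xs)"
  shows "(\<forall>x. f x = fenchel_biconj h (bidual_embed x)) \<and>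
    ((\<forall>x. k x \<le> f x) \<and> (\<forall>x. f x \<noteq> -\<infinity>)) \<and>
    (proper_fun f \<and> convex_fun f \<and> lower_semicontinuous f \<and>
      (\<forall>xs. fenchel_conj f xs = fenchel_conj h xs))"
proof -
  let ?hs = "fenchel_conj h"
  obtain x0 where x0: "\<bar>h x0\<bar> \<noteq> \<infinity>"
    using h_proper[unfolded proper_fun_def] by (rule exE)
  have hs: "?hs xs \<noteq> - \<infinity>" for xs
    using x0 by (intro fenchel_conj_neq_MInf[of h x0]) auto
  have f_def: "f = (\<lambda>x. SUP xs. ereal (blinfun_apply xs x) - ?hs xs)"
    using f_eq by auto
  have f_upper: "ereal (blinfun_apply xs x) - ?hs xs \<le> f x" for xs x
    unfolding f_def by (rule SUP_upper) simp
  have bic: "f x = fenchel_biconj h (bidual_embed x)" for x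
    by (simp add: f_def fenchel_biconj_def fenchel_conj_def[of "fenchel_conj h"])
  have k_le_f: "k x \<le> f x" for x
  proof (rule ccontr)
    assume "\<not> k x \<le> f x"
    then obtain c where c: "f x < ereal c" "ereal c < k x"
      using ereal_dense2[of "f x" "k x"] by (auto simp: not_le)
    obtain xs :: "'a \<Rightarrow>\<^sub>L real" where "\<And>y. ereal (c + xs (y - x)) \<le> h y"
      using affine_minorant_below_lsc_minorant[OF h_convex x0 k_lsc _ _ c(2)] k_gt k_le_h by metis
    then have "?hs xs \<le> ereal (xs x - c)"
      by (rule fenchel_conj_le_of_affine_minorant)
    then have "ereal c \<le> ereal (xs x) - ?hs xs"
      using hs[of xs] by (cases "?hs xs") auto
    with f_upper[of xs x] c(1) show False
      by simp
  qed
  have f_gt: "f x \<noteq> - \<infinity>" for x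
    using k_le_f[of x] k_gt by auto
  have f_le_h: "f x \<le> h x" for x
    unfolding f_def
  proof (rule SUP_least)
    fix xs
    show "ereal (blinfun_apply xs x) - ?hs xs \<le> h x"
      using fenchel_young[of xs x h] h_gt hs[of xs] by (cases "h x"; cases "?hs xs") auto
  qed
  have "proper_fun f"
    unfolding proper_fun_def using f_gt[of x0] f_le_h[of x0] x0 by (intro exI[of _ x0]) auto
  moreover have "convex_fun f" "lower_semicontinuous f"
    unfolding f_def using hs by (rule convex_fun_SUP_affine lower_semicontinuous_SUP_affine)+
  moreover have "fenchel_conj f xs = ?hs xs" for xs
  proof (rule antisym)
    show "?hs xs \<le> fenchel_conj f xs"
      using f_le_h by (rule fenchel_conj_antimono)
    show "fenchel_conj f xs \<le> ?hs xs"
      unfolding fenchel_conj_def[of f]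
    proof (rule SUP_least)
      fix x
      show "ereal (blinfun_apply xs x) - f x \<le> ?hs xs"
        using f_upper[of xs x] f_gt[of x] hs[of xs] by (cases "f x"; cases "?hs xs") auto
    qed
  qed
  ultimately show ?thesis
    using bic k_le_f f_gt by blast
qed

end
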